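(* (Dynamic regret of stochastic online gradient descent with additive noise.) Let $p\ge1$, $L>0$, $\alpha\ge0$. For every $t\ge0$ let $0<m_t\le L_t$, $\sigma_t\ge0$, $c_t\ge0$, $\alpha\le\frac2{L_t}$, and let $f_t\in\mathcal S(m_t,L_t)$ be (deterministic and) $L$-smooth with global minimizer $x_t^*\in\mathbb R^p$. Consider $x_{t+1}=x_t-\alpha(\nabla f_t(x_t)+v_t)$ with deterministic $x_0$, and assume $\|x_{t+1}^*-x_t^*\|\le\sigma_t$ for all $t$ and that $\{v_t\}$ is a zero-mean IID process with $\mathbb E\|v_t\|^2\le c_t^2$ for all $t$. Suppose $\mu_t=\mu$ for all $t$, with $\mu<1$, and let $\hat U_0=\|x_0-x_0^*\|^2$. Then for every $T\ge0$, $$\sum_{t=0}^T\mathbb E\left(f_t(x_t)-f_t(x_t^* )\right)\le\frac{L}{(1-\mu)^2}\hat U_0+\frac{2L}{(1-\mu)^2}\left(\sum_{t=0}^{T-1}\sigma_t\right)^2+\frac{2L\alpha^2}{(1-\mu)^2}\left(\sum_{t=0}^{T-1}c_t\right)^2.$$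
   Context: $\mathcal S(m,L)$ is the set of differentiable functions $f:\mathbb R^p\to\mathbb R$ having a unique global minimizer $x^*$ such that for all $x\in\mathbb R^p$ $$\begin{bmatrix}x-x^*\\ \nabla f(x)\end{bmatrix}^T\begin{bmatrix}-2mLI_p&(L+m)I_p\\(L+m)I_p&-2I_p\end{bmatrix}\begin{bmatrix}x-x^*\\ \nabla f(x)\end{bmatrix}\ge0.$$ $\mu_t:=1-m_t\alpha$ if $0\le\alpha\le\frac{2}{m_t+L_t}$, and $\mu_t:=\alpha L_t-1$ if $\frac{2}{m_t+L_t}\le\alpha\le\frac{2}{L_t}$. $f$ is $L$-smooth if $\nabla f$ is $L$-Lipschitz. Empty sums are zero. *)

theory Defs
  imports "HOL-Probability.Probability"
begin

definition gradient :: "('a::real_inner \<Rightarrow> real) \<Rightarrow> 'a \<Rightarrow> 'a" where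
  "gradient f x = (THE g. GDERIV f x :> g)"

definition smooth_fun :: "real \<Rightarrow> ('a::real_inner \<Rightarrow> real) \<Rightarrow> bool" where
  "smooth_fun L f \<longleftrightarrow> (\<forall>x. f differentiable (at x)) \<and> L-lipschitz_on UNIV (gradient f)"

definition is_global_minimizer :: "('a \<Rightarrow> real) \<Rightarrow> 'a \<Rightarrow> bool" where
  "is_global_minimizer f z \<longleftrightarrow> is_arg_min f (\<lambda>_. True) z"

text \<open>Block vectors and matrices are indexed by the disjoint sum of the index types.\<close>

definition block_vec :: "real ^ 'm \<Rightarrow> real ^ 'n \<Rightarrow> real ^ ('m::finite + 'n::finite)" where
  "block_vec u w = (\<chi> i. case i of Inl a \<Rightarrow> u $ a | Inr b \<Rightarrow> w $ b)"

definition block_mat ::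
  "real ^ 'm ^ 'm \<Rightarrow> real ^ 'n ^ 'm \<Rightarrow> real ^ 'm ^ 'n \<Rightarrow> real ^ 'n ^ 'n
    \<Rightarrow> real ^ ('m::finite + 'n::finite) ^ ('m + 'n)" where
  "block_mat A B C D =
    (\<chi> i j. case i of
       Inl a \<Rightarrow> (case j of Inl a' \<Rightarrow> A $ a $ a' | Inr b' \<Rightarrow> B $ a $ b')
     | Inr b \<Rightarrow> (case j of Inl a' \<Rightarrow> C $ b $ a' | Inr b' \<Rightarrow> D $ b $ b'))"

text \<open>Here \<^term>\<open>mat c\<close> is \<open>c\<close> times the identity matrix.\<close>

definition sector_matrix :: "real \<Rightarrow> real \<Rightarrow> real ^ ('p::finite + 'p) ^ ('p + 'p)" where
  "sector_matrix m L =
    block_mat (mat (- 2 * m * L)) (mat (L + m)) (mat (L + m)) (mat (- 2))"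

definition sector_class :: "real \<Rightarrow> real \<Rightarrow> (real ^ 'p::finite \<Rightarrow> real) set" where
  "sector_class m L =
    {f. (\<forall>x. f differentiable (at x)) \<and>
        (\<exists>z. is_global_minimizer f z \<and> (\<forall>y. is_global_minimizer f y \<longrightarrow> y = z) \<and>
          (\<forall>x. block_vec (x - z) (gradient f x)
                 \<bullet> (sector_matrix m L *v block_vec (x - z) (gradient f x)) \<ge> 0))}"

text \<open>The two branches agree at \<open>\<alpha> = 2 / (m + L)\<close>; the value is only meaningful for
  \<open>0 \<le> \<alpha> \<le> 2 / L\<close>.\<close>

definition contraction_rate :: "real \<Rightarrow> real \<Rightarrow> real \<Rightarrow> real" where
  "contraction_rate m L \<alpha> = (if \<alpha> \<le> 2 / (m + L) then 1 - m * \<alpha> else \<alpha> * L - 1)"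

end

theory Submission
  imports Defs
begin

text \<open>The sector condition says that the gradient deviates from
  \<open>((L\<^sub>t + m\<^sub>t) / 2) (x - x\<^sub>t\<^sup>*)\<close> by at most \<open>((L\<^sub>t - m\<^sub>t) / 2) \<parallel>x - x\<^sub>t\<^sup>*\<parallel>\<close>, so a noiseless
  gradient step contracts the error by \<open>\<mu>\<close>. Hence, pathwise, the errors \<open>n\<^sub>t = \<parallel>x\<^sub>t - x\<^sub>t\<^sup>*\<parallel>\<close> satisfy
  \<open>n\<^bsub>t+1\<^esub> \<le> \<mu> n\<^sub>t + \<sigma>\<^sub>t + \<alpha> \<parallel>v\<^sub>t\<parallel>\<close>, which bounds \<open>\<Sum>n\<^sub>t\<close> linearly. Since
  \<open>f\<^sub>t(x\<^sub>t) - f\<^sub>t(x\<^sub>t\<^sup>*) \<le> (L/2) n\<^sub>t\<^sup>2\<close> and \<open>\<Sum>n\<^sub>t\<^sup>2 \<le> (\<Sum>n\<^sub>t)\<^sup>2\<close>, expectations enter only through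
  \<open>(\<Sum>\<parallel>v\<^sub>t\<parallel>)\<^sup>2\<close>, which Cauchy-Schwarz bounds by \<open>(\<Sum>c\<^sub>t)\<^sup>2\<close>.\<close>

section \<open>Existence of gradients\<close>

text \<open>\<open>gradient\<close> is a definite description, so existence and uniqueness must be
  supplied before it can be used. The vector with coordinates \<open>f' b\<close> represents the
  derivative as an inner product, and uniqueness of derivatives determines it.\<close>

lemma GDERIV_gradient:
  fixes f :: "'a::euclidean_space \<Rightarrow> real"
  assumes "f differentiable (at x)"
  shows "GDERIV f x :> gradient f x"
proof -
  obtain f' where f': "(f has_derivative f') (at x)"
    using assms by (auto simp: differentiable_def)
  then have lin: "linear f'"
    by (rule has_derivative_linear)
  define g where "g = (\<Sum>b\<in>Basis. f' b *\<^sub>R b)"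
  have "f' h = h \<bullet> g" for h
  proof -
    have "f' h = f' (\<Sum>b\<in>Basis. (h \<bullet> b) *\<^sub>R b)"
      by (simp only: euclidean_representation)
    also have "\<dots> = h \<bullet> g"
      by (simp add: g_def linear_sum[OF lin] linear_cmul[OF lin] inner_sum_right mult.commute)
    finally show ?thesis .
  qed
  then have g: "GDERIV f x :> g"
    using f' by (simp add: gderiv_def flip: \<open>\<And>h. f' h = h \<bullet> g\<close>)
  have "y = g" if "GDERIV f x :> y" for y
  proof -
    have "(\<lambda>h. h \<bullet> y) = (\<lambda>h. h \<bullet> g)"
      using that g unfolding gderiv_def by (rule has_derivative_unique)
    then show ?thesis
      by (metis vector_eq_ldot)
  qed
  with g show ?thesis
    unfolding gradient_def by (rule theI)
qed

section \<open>Block matrices and the sector condition\<close>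

lemma sum_UNIV_sum_type:
  "(\<Sum>i\<in>UNIV. h i) = (\<Sum>i\<in>UNIV. h (Inl i)) + (\<Sum>i\<in>UNIV. h (Inr i))"
  for h :: "'m::finite + 'n::finite \<Rightarrow> 'a::comm_monoid_add"
  by (subst UNIV_Plus_UNIV[symmetric], subst sum.Plus) simp_all

lemma block_mat_mult_block_vec:
  "block_mat A B C D *v block_vec u w = block_vec (A *v u + B *v w) (C *v u + D *v w)"
  by (simp add: vec_eq_iff block_mat_def block_vec_def matrix_vector_mult_def sum_UNIV_sum_type
        split: sum.split)

lemma mat_vector_mult: "mat k *v (u :: real ^ 'n::finite) = k *\<^sub>R u"
  by (simp add: vec_eq_iff matrix_vector_mult_def mat_def if_distrib[of "\<lambda>x. x * _"] cong: if_cong)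

lemma inner_block_vec: "block_vec u w \<bullet> block_vec u' w' = u \<bullet> u' + w \<bullet> w'"
  by (simp add: block_vec_def inner_vec_def sum_UNIV_sum_type)

text \<open>Completing the square in \<open>g\<close>: the leftover coefficient of
  \<open>norm e\<close> squared comes from ((L + m)/2)^2 - m L = ((L - m)/2)^2.\<close>

lemma sector_quadratic_form:
  "block_vec e g \<bullet> (sector_matrix m L *v block_vec e g)
     = 2 * ((L - m) / 2)\<^sup>2 * (norm e)\<^sup>2 - 2 * (norm (g - ((L + m) / 2) *\<^sub>R e))\<^sup>2"
  unfolding sector_matrix_def block_mat_mult_block_vec inner_block_vec mat_vector_mult
  by (simp add: power2_norm_eq_inner inner_diff inner_add inner_commute[of g e])
     (simp add: algebra_simps power2_eq_square field_simps)

text \<open>Nonnegativity of the completed square, after taking roots. The class only asserts that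
  some minimizer satisfies the sector inequality; its uniqueness identifies that one with the given
  \<open>z\<close>.\<close>

lemma sector_class_gradient_bound:
  assumes "f \<in> sector_class m L" "is_global_minimizer f z" "m \<le> L"
  shows "norm (gradient f x - ((L + m) / 2) *\<^sub>R (x - z)) \<le> (L - m) / 2 * norm (x - z)"
proof -
  have "block_vec (x - z) (gradient f x)
          \<bullet> (sector_matrix m L *v block_vec (x - z) (gradient f x)) \<ge> 0"
    using assms(1,2) unfolding sector_class_def by blast
  then have "(norm (gradient f x - ((L + m) / 2) *\<^sub>R (x - z)))\<^sup>2
      \<le> ((L - m) / 2 * norm (x - z))\<^sup>2"
    unfolding sector_quadratic_form power_mult_distrib by linarith
  then show ?thesis
    by (rule power2_le_imp_le) (use \<open>m \<le> L\<close> in simp)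
qed

section \<open>Contraction of a gradient step\<close>

text \<open>The step scales the error by 1 - \<alpha> (L + m)/2 and adds a remainder of norm at most
  \<alpha> (L - m)/2 times the error. The two signs inside the absolute value produce the two
  branches of \<open>contraction_rate\<close>.\<close>

lemma gradient_step_contraction:
  assumes "f \<in> sector_class m L" "is_global_minimizer f z" "0 < m" "m \<le> L" "0 \<le> \<alpha>"
  shows "norm (x - \<alpha> *\<^sub>R gradient f x - z) \<le> contraction_rate m L \<alpha> * norm (x - z)"
proof -
  let ?r = "gradient f x - ((L + m) / 2) *\<^sub>R (x - z)"
  have "x - \<alpha> *\<^sub>R gradient f x - z = (1 - \<alpha> * ((L + m) / 2)) *\<^sub>R (x - z) - \<alpha> *\<^sub>R ?r"
    by (simp add: algebra_simps)
  also have "norm \<dots> \<le> \<bar>1 - \<alpha> * ((L + m) / 2)\<bar> * norm (x - z) + \<alpha> * norm ?r"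
    using norm_triangle_ineq4 \<open>0 \<le> \<alpha>\<close> by (metis abs_of_nonneg norm_scaleR)
  also have "\<dots> \<le> \<bar>1 - \<alpha> * ((L + m) / 2)\<bar> * norm (x - z) + \<alpha> * ((L - m) / 2 * norm (x - z))"
    using sector_class_gradient_bound[OF assms(1,2,4)] \<open>0 \<le> \<alpha>\<close>
    by (intro add_left_mono mult_left_mono)
  also have "\<dots> = (\<bar>1 - \<alpha> * ((L + m) / 2)\<bar> + \<alpha> * ((L - m) / 2)) * norm (x - z)"
    by (simp add: algebra_simps)
  also have "\<bar>1 - \<alpha> * ((L + m) / 2)\<bar> + \<alpha> * ((L - m) / 2) = contraction_rate m L \<alpha>"
    using \<open>0 < m\<close> \<open>m \<le> L\<close> by (auto simp: contraction_rate_def field_simps abs_if)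
  finally show ?thesis .
qed

text \<open>Each branch is at least (L - m)/(L + m), their common value at the breakpoint.\<close>

lemma contraction_rate_nonneg:
  assumes "0 < m" "m \<le> L"
  shows "0 \<le> contraction_rate m L \<alpha>"
proof (cases "\<alpha> \<le> 2 / (m + L)")
  case True
  then have "m * \<alpha> \<le> m * (2 / (m + L))"
    using assms by (intro mult_left_mono) auto
  also have "\<dots> \<le> 1"
    using assms by (simp add: field_simps)
  finally show ?thesis
    using True by (simp add: contraction_rate_def)
next
  case False
  then have "2 / (m + L) * L \<le> \<alpha> * L"
    using assms by (intro mult_right_mono) auto
  moreover have "1 \<le> 2 / (m + L) * L"
    using assms by (simp add: field_simps)
  ultimately show ?thesis
    using False by (simp add: contraction_rate_def)
qed

section \<open>Quadratic upper bound for smooth functions\<close>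

text \<open>The descent lemma, proved without integrating the gradient: along the segment from
  \<open>z\<close> to \<open>x\<close>, the function minus its quadratic model is nonincreasing,
  because the Lipschitz bound and Cauchy-Schwarz make its derivative nonpositive.\<close>

lemma smooth_fun_upper_bound:
  fixes f :: "'a::euclidean_space \<Rightarrow> real"
  assumes "smooth_fun L f"
  shows "f x - f z \<le> gradient f z \<bullet> (x - z) + L / 2 * (norm (x - z))\<^sup>2"
proof -
  let ?e = "x - z"
  define \<phi> where "\<phi> s = f (z + s *\<^sub>R ?e) - s * (gradient f z \<bullet> ?e) - L / 2 * s\<^sup>2 * (norm ?e)\<^sup>2"
    for s :: real
  let ?\<phi>' = "\<lambda>s. (gradient f (z + s *\<^sub>R ?e) - gradient f z) \<bullet> ?e - L * s * (norm ?e)\<^sup>2"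
  have deriv: "(\<phi> has_real_derivative ?\<phi>' s) (at s)" for s
  proof -
    have "GDERIV f (z + s *\<^sub>R ?e) :> gradient f (z + s *\<^sub>R ?e)"
      using assms by (intro GDERIV_gradient) (simp add: smooth_fun_def)
    then have fd: "(f has_derivative (\<lambda>h. h \<bullet> gradient f (z + s *\<^sub>R ?e))) (at (z + s *\<^sub>R ?e))"
      by (simp add: gderiv_def)
    have "((\<lambda>s. f (z + s *\<^sub>R ?e)) has_derivative
           (\<lambda>h. (h *\<^sub>R ?e) \<bullet> gradient f (z + s *\<^sub>R ?e))) (at s)"
      by (rule has_derivative_compose[where f = "\<lambda>s. z + s *\<^sub>R ?e" and g = f, OF _ fd]) (auto intro!: derivative_eq_intros)
    then have "((\<lambda>s. f (z + s *\<^sub>R ?e)) has_real_derivative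
           (gradient f (z + s *\<^sub>R ?e) \<bullet> ?e)) (at s)"
      by (simp add: has_field_derivative_def inner_commute mult.commute[of _ "_ \<bullet> _"])
    then show ?thesis
      unfolding \<phi>_def by (auto intro!: derivative_eq_intros simp: inner_diff_left)
  qed
  have deriv_nonpos: "?\<phi>' s \<le> 0" if "0 \<le> s" for s
  proof -
    have "norm (gradient f (z + s *\<^sub>R ?e) - gradient f z) \<le> L * norm (s *\<^sub>R ?e)"
      using assms lipschitz_onD[of L UNIV "gradient f" "z + s *\<^sub>R ?e" z]
      by (simp add: smooth_fun_def dist_norm)
    then have "norm (gradient f (z + s *\<^sub>R ?e) - gradient f z) * norm ?e
        \<le> L * norm (s *\<^sub>R ?e) * norm ?e"
      by (intro mult_right_mono norm_ge_zero)
    also have "\<dots> = L * s * (norm ?e)\<^sup>2"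
      using that by (simp only: norm_scaleR abs_of_nonneg power2_eq_square mult.assoc)
    finally show ?thesis
      using norm_cauchy_schwarz[of "gradient f (z + s *\<^sub>R ?e) - gradient f z" ?e] by linarith
  qed
  have "\<phi> 1 \<le> \<phi> 0"
  proof (rule DERIV_nonpos_imp_nonincreasing[of 0 1 \<phi>])
    show "\<exists>y. (\<phi> has_real_derivative y) (at s) \<and> y \<le> 0" if "0 \<le> s" "s \<le> 1" for s
      using deriv[of s] deriv_nonpos[OF that(1)] by (intro exI conjI)
  qed simp
  then show ?thesis
    by (simp add: \<phi>_def)
qed

section \<open>Sums along the error recursion\<close>

text \<open>Summing the recursion before solving it avoids geometric series: the same sum appears on
  both sides, with factor \<mu> on the right, and can be absorbed.\<close>

lemma affine_recursion_sum_bound: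
  fixes n b :: "nat \<Rightarrow> real"
  assumes "0 \<le> \<mu>" "\<mu> < 1" and nonneg: "\<And>t. 0 \<le> n t"
    and step: "\<And>t. n (Suc t) \<le> \<mu> * n t + b t"
  shows "(\<Sum>t\<le>T. n t) \<le> (n 0 + (\<Sum>t<T. b t)) / (1 - \<mu>)"
proof -
  have "(\<Sum>t\<le>T. n t) = n 0 + (\<Sum>t<T. n (Suc t))"
    by (rule sum.atMost_shift)
  also have "(\<Sum>t<T. n (Suc t)) \<le> (\<Sum>t<T. \<mu> * n t + b t)"
    by (intro sum_mono step)
  also have "\<dots> = \<mu> * (\<Sum>t<T. n t) + (\<Sum>t<T. b t)"
    by (simp add: sum.distrib sum_distrib_left)
  \<comment> \<open>Adding the nonnegative term \<open>n T\<close> makes this sum match the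
    left-hand side.\<close>
  also have "\<mu> * (\<Sum>t<T. n t) \<le> \<mu> * (\<Sum>t\<le>T. n t)"
    using \<open>0 \<le> \<mu>\<close> nonneg by (intro mult_left_mono sum_mono2) auto
  finally have "(1 - \<mu>) * (\<Sum>t\<le>T. n t) \<le> n 0 + (\<Sum>t<T. b t)"
    by (simp add: algebra_simps)
  then show ?thesis
    using \<open>\<mu> < 1\<close> by (simp add: pos_le_divide_eq mult.commute)
qed

lemma sum_squares_le_square_sum:
  fixes n :: "'i \<Rightarrow> real"
  assumes "finite A" "\<And>t. t \<in> A \<Longrightarrow> 0 \<le> n t"
  shows "(\<Sum>t\<in>A. (n t)\<^sup>2) \<le> (\<Sum>t\<in>A. n t)\<^sup>2"
proof -
  have "n t * n t \<le> n t * (\<Sum>s\<in>A. n s)" if "t \<in> A" for t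
    using assms that by (intro mult_left_mono member_le_sum) auto
  then have "(\<Sum>t\<in>A. n t * n t) \<le> (\<Sum>t\<in>A. n t * (\<Sum>s\<in>A. n s))"
    by (intro sum_mono)
  then show ?thesis
    by (simp add: power2_eq_square sum_distrib_right)
qed

section \<open>Second moments of sums\<close>

lemma integrable_mult_of_square_integrable:
  fixes g h :: "'a \<Rightarrow> real"
  assumes [measurable]: "g \<in> borel_measurable M" "h \<in> borel_measurable M"
    and "integrable M (\<lambda>x. (g x)\<^sup>2)" "integrable M (\<lambda>x. (h x)\<^sup>2)"
  shows "integrable M (\<lambda>x. g x * h x)"
proof (rule Bochner_Integration.integrable_bound)
  show "integrable M (\<lambda>x. (g x)\<^sup>2 + (h x)\<^sup>2)"
    using assms by simp
  have "\<bar>g x * h x\<bar> \<le> (g x)\<^sup>2 + (h x)\<^sup>2" for x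
    using sum_squares_bound[of "\<bar>g x\<bar>" "\<bar>h x\<bar>"] zero_le_mult_iff[of "\<bar>g x\<bar>" "\<bar>h x\<bar>"]
    unfolding abs_mult power2_abs by linarith
  then show "AE x in M. norm (g x * h x) \<le> norm ((g x)\<^sup>2 + (h x)\<^sup>2)"
    by simp
qed simp

text \<open>The integral of the square of \<open>a * g + b * h\<close> is a nonnegative quadratic
  form in \<open>a\<close> and \<open>b\<close>, so its discriminant has the right sign.\<close>

lemma Cauchy_Schwarz_integral:
  fixes g h :: "'a \<Rightarrow> real"
  assumes [measurable]: "g \<in> borel_measurable M" "h \<in> borel_measurable M"
    and g: "integrable M (\<lambda>x. (g x)\<^sup>2)" and h: "integrable M (\<lambda>x. (h x)\<^sup>2)"
  shows "(LINT x|M. g x * h x)\<^sup>2 \<le> (LINT x|M. (g x)\<^sup>2) * (LINT x|M. (h x)\<^sup>2)"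
proof -
  define A B C where "A = (LINT x|M. (g x)\<^sup>2)" "B = (LINT x|M. g x * h x)" "C = (LINT x|M. (h x)\<^sup>2)"
  have gh: "integrable M (\<lambda>x. g x * h x)"
    using assms by (rule integrable_mult_of_square_integrable)
  have quad: "0 \<le> a\<^sup>2 * A + 2 * a * b * B + b\<^sup>2 * C" for a b
  proof -
    have "0 \<le> (LINT x|M. (a * g x + b * h x)\<^sup>2)"
      by simp
    also have "\<dots> = (LINT x|M. a\<^sup>2 * (g x)\<^sup>2 + 2 * a * b * (g x * h x) + b\<^sup>2 * (h x)\<^sup>2)"
      by (simp add: power2_sum power_mult_distrib algebra_simps)
    also have "\<dots> = a\<^sup>2 * A + 2 * a * b * B + b\<^sup>2 * C"
      using g h gh by (simp add: A_B_C_def)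
    finally show ?thesis .
  qed
  have "A \<ge> 0" "C \<ge> 0"
    by (simp_all add: A_B_C_def)
  \<comment> \<open>The choices (C, -B) and (-B, A) factor out the determinant without dividing,
    leaving only the case A = C = 0 to treat apart.\<close>
  have "0 \<le> C * (A * C - B\<^sup>2)" "0 \<le> A * (A * C - B\<^sup>2)"
    using quad[of C "- B"] quad[of "- B" A] by (simp_all add: power2_eq_square algebra_simps)
  moreover have "B = 0" if "A = 0" "C = 0"
    using quad[of 1 1] quad[of 1 "- 1"] that by simp
  ultimately have "B\<^sup>2 \<le> A * C"
    using \<open>A \<ge> 0\<close> \<open>C \<ge> 0\<close> by (cases "A = 0 \<and> C = 0") (auto simp: zero_le_mult_iff)
  then show ?thesis
    by (simp add: A_B_C_def)
qed

text \<open>Expanding the square, Cauchy-Schwarz bounds each mixed moment by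
  \<open>c s * c t\<close>, and these products reassemble into the square of the sum.\<close>

lemma
  fixes u :: "'i \<Rightarrow> 'a \<Rightarrow> real"
  assumes meas: "\<And>t. t \<in> A \<Longrightarrow> u t \<in> borel_measurable M"
    and sq: "\<And>t. t \<in> A \<Longrightarrow> integrable M (\<lambda>x. (u t x)\<^sup>2)"
  shows integrable_square_sum: "integrable M (\<lambda>x. (\<Sum>t\<in>A. u t x)\<^sup>2)"
    and integral_square_sum_le:
      "\<lbrakk>\<And>t. t \<in> A \<Longrightarrow> 0 \<le> c t; \<And>t. t \<in> A \<Longrightarrow> (LINT x|M. (u t x)\<^sup>2) \<le> (c t)\<^sup>2\<rbrakk>
        \<Longrightarrow> (LINT x|M. (\<Sum>t\<in>A. u t x)\<^sup>2) \<le> (\<Sum>t\<in>A. c t)\<^sup>2"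
proof -
  have prod: "integrable M (\<lambda>x. u s x * u t x)" if "s \<in> A" "t \<in> A" for s t
    using that by (intro integrable_mult_of_square_integrable meas sq)
  then show "integrable M (\<lambda>x. (\<Sum>t\<in>A. u t x)\<^sup>2)"
    by (auto simp: power2_eq_square sum_product)
  assume c: "\<And>t. t \<in> A \<Longrightarrow> 0 \<le> c t" "\<And>t. t \<in> A \<Longrightarrow> (LINT x|M. (u t x)\<^sup>2) \<le> (c t)\<^sup>2"
  have "(LINT x|M. u s x * u t x) \<le> c s * c t" if "s \<in> A" "t \<in> A" for s t
  proof (rule power2_le_imp_le)
    have "(LINT x|M. u s x * u t x)\<^sup>2 \<le> (LINT x|M. (u s x)\<^sup>2) * (LINT x|M. (u t x)\<^sup>2)"
      using that by (intro Cauchy_Schwarz_integral meas sq)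
    also have "\<dots> \<le> (c s)\<^sup>2 * (c t)\<^sup>2"
      using that c by (intro mult_mono) auto
    finally show "(LINT x|M. u s x * u t x)\<^sup>2 \<le> (c s * c t)\<^sup>2"
      by (simp add: power_mult_distrib)
  qed (use that c in simp)
  then have "(\<Sum>s\<in>A. \<Sum>t\<in>A. LINT x|M. u s x * u t x) \<le> (\<Sum>s\<in>A. \<Sum>t\<in>A. c s * c t)"
    by (intro sum_mono)
  then show "(LINT x|M. (\<Sum>t\<in>A. u t x)\<^sup>2) \<le> (\<Sum>t\<in>A. c t)\<^sup>2"
    using prod by (simp add: power2_eq_square sum_product)
qed

section \<open>Dynamic regret: from pathwise bounds to expectations\<close>

theorem mainTheorem17:
  fixes M :: "'w measure"
    and L \<alpha> \<mu> :: real
    and m Ls \<sigma> c :: "nat \<Rightarrow> real"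
    and f :: "nat \<Rightarrow> real ^ 'p::finite \<Rightarrow> real"
    and xs :: "nat \<Rightarrow> real ^ 'p"
    and x0 :: "real ^ 'p"
    and x v :: "nat \<Rightarrow> 'w \<Rightarrow> real ^ 'p"
    and T :: nat
  assumes "prob_space M"
    and "L > 0" and "\<alpha> \<ge> 0"
    and "\<And>t. 0 < m t" and "\<And>t. m t \<le> Ls t"
    and "\<And>t. \<sigma> t \<ge> 0" and "\<And>t. c t \<ge> 0"
    and "\<And>t. \<alpha> \<le> 2 / Ls t"
    and "\<And>t. f t \<in> sector_class (m t) (Ls t)"
    and "\<And>t. smooth_fun L (f t)"
    and "\<And>t. is_global_minimizer (f t) (xs t)"
    and "\<And>\<omega>. \<omega> \<in> space M \<Longrightarrow> x 0 \<omega> = x0"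
    and "\<And>t \<omega>. \<omega> \<in> space M \<Longrightarrow>
           x (Suc t) \<omega> = x t \<omega> - \<alpha> *\<^sub>R (gradient (f t) (x t \<omega>) + v t \<omega>)"
    and "\<And>t. norm (xs (Suc t) - xs t) \<le> \<sigma> t"
    and "prob_space.indep_vars M (\<lambda>_. borel) v UNIV"
    and "\<And>s t. distr M borel (v s) = distr M borel (v t)"
    and "\<And>t. integrable M (v t)" and "\<And>t. (LINT \<omega>|M. v t \<omega>) = 0"
    and "\<And>t. integrable M (\<lambda>\<omega>. (norm (v t \<omega>))\<^sup>2)"
    and "\<And>t. (LINT \<omega>|M. (norm (v t \<omega>))\<^sup>2) \<le> (c t)\<^sup>2"
    and "\<And>t. contraction_rate (m t) (Ls t) \<alpha> = \<mu>"
    and "\<mu> < 1"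
  shows "(\<forall>t. integrable M (\<lambda>\<omega>. f t (x t \<omega>) - f t (xs t))) \<and>
    (\<Sum>t\<le>T. LINT \<omega>|M. f t (x t \<omega>) - f t (xs t))
      \<le> L / (1 - \<mu>)\<^sup>2 * (norm (x0 - xs 0))\<^sup>2
        + 2 * L / (1 - \<mu>)\<^sup>2 * (\<Sum>t<T. \<sigma> t)\<^sup>2
        + 2 * L * \<alpha>\<^sup>2 / (1 - \<mu>)\<^sup>2 * (\<Sum>t<T. c t)\<^sup>2"
proof -
  interpret prob_space M by fact
  note diff = \<open>\<And>t. smooth_fun L (f t)\<close>[unfolded smooth_fun_def]
  have [measurable]: "v t \<in> borel_measurable M" for t
    using assms(17) by (rule borel_measurable_integrable)
  have [measurable]: "f t \<in> borel_measurable borel" for t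
    using diff by (intro borel_measurable_continuous_onI)
      (auto simp: continuous_on_eq_continuous_at differentiable_imp_continuous_within)
  have [measurable]: "gradient (f t) \<in> borel_measurable borel" for t
    using diff by (intro borel_measurable_continuous_onI) (blast intro: lipschitz_on_continuous_on)
  \<comment> \<open>The recursion is given only on \<open>space M\<close>, so measurability passes
    through congruence on that set.\<close>
  have [measurable]: "x t \<in> borel_measurable M" for t
  proof (induction t)
    case 0
    show ?case
      using assms(12) by (subst measurable_cong[where g = "\<lambda>_. x0"]) auto
  next
    case (Suc t)
    note [measurable] = Suc
    show ?case
      using assms(13) by (subst measurable_cong) auto
  qed
  have "0 \<le> \<mu>"
    using contraction_rate_nonneg assms(4,5,21) by metis
  define n where "n t \<omega> = norm (x t \<omega> - xs t)" for t \<omega>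
  let ?gap = "\<lambda>t \<omega>. f t (x t \<omega>) - f t (xs t)"
  define V where "V k \<omega> = (\<Sum>t<k. norm (v t \<omega>))" for k \<omega>
  \<comment> \<open>The claimed bound before taking expectations, with the random \<open>V k\<close>
    in place of the sum of the \<open>c t\<close>. The horizon \<open>k\<close> is left free since
    integrability is needed at every time.\<close>
  define bd where "bd k \<omega> = L / (1 - \<mu>)\<^sup>2 * (norm (x0 - xs 0))\<^sup>2
      + 2 * L / (1 - \<mu>)\<^sup>2 * (\<Sum>t<k. \<sigma> t)\<^sup>2 + 2 * L * \<alpha>\<^sup>2 / (1 - \<mu>)\<^sup>2 * (V k \<omega>)\<^sup>2" for k \<omega>
  have gap_nonneg: "0 \<le> ?gap t \<omega>" for t \<omega>
    using assms(11)[of t] by (auto simp: is_global_minimizer_def is_arg_min_linorder)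
  have gap_le: "?gap t \<omega> \<le> L / 2 * (n t \<omega>)\<^sup>2" for t \<omega>
  proof -
    \<comment> \<open>At the minimizer itself the right-hand side of the sector bound is
      zero.\<close>
    have "gradient (f t) (xs t) = 0"
      using sector_class_gradient_bound[OF assms(9)[of t] assms(11)[of t] assms(5)[of t], of "xs t"] by simp
    then show ?thesis
      using smooth_fun_upper_bound[OF assms(10)[of t], of "x t \<omega>" "xs t"] by (simp add: n_def)
  qed
  have step: "n (Suc t) \<omega> \<le> \<mu> * n t \<omega> + (\<sigma> t + \<alpha> * norm (v t \<omega>))" if "\<omega> \<in> space M" for t \<omega>
  proof -
    \<comment> \<open>Noiseless step towards the old minimizer, minus minimizer drift and
      noise.\<close>
    have "x (Suc t) \<omega> - xs (Suc t) = (x t \<omega> - \<alpha> *\<^sub>R gradient (f t) (x t \<omega>) - xs t)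
        - ((xs (Suc t) - xs t) + \<alpha> *\<^sub>R v t \<omega>)"
      using assms(13)[OF that] by (simp add: algebra_simps)
    then have "n (Suc t) \<omega> \<le> norm (x t \<omega> - \<alpha> *\<^sub>R gradient (f t) (x t \<omega>) - xs t)
        + norm ((xs (Suc t) - xs t) + \<alpha> *\<^sub>R v t \<omega>)"
      unfolding n_def by (simp only: norm_triangle_ineq4)
    also have "norm ((xs (Suc t) - xs t) + \<alpha> *\<^sub>R v t \<omega>)
        \<le> norm (xs (Suc t) - xs t) + norm (\<alpha> *\<^sub>R v t \<omega>)"
      by (rule norm_triangle_ineq)
    finally show ?thesis
      using gradient_step_contraction[OF assms(9)[of t] assms(11)[of t] assms(4)[of t] assms(5)[of t] assms(3),
        of "x t \<omega>"] assms(3,21)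
        assms(14)[of t] by (simp add: n_def)
  qed
  have gaps_le: "(\<Sum>t\<le>k. ?gap t \<omega>) \<le> bd k \<omega>" if \<omega>: "\<omega> \<in> space M" for k \<omega>
  proof -
    define S where "S = (\<Sum>t<k. \<sigma> t)"
    have sum_n: "(\<Sum>t\<le>k. n t \<omega>) \<le> (n 0 \<omega> + (S + \<alpha> * V k \<omega>)) / (1 - \<mu>)"
      using affine_recursion_sum_bound[where n = "\<lambda>t. n t \<omega>"
          and b = "\<lambda>t. \<sigma> t + \<alpha> * norm (v t \<omega>)", OF \<open>0 \<le> \<mu>\<close> \<open>\<mu> < 1\<close> _ step[OF \<omega>], of k]
      by (simp add: n_def S_def V_def sum.distrib sum_distrib_left)
    \<comment> \<open>Using (a + b)^2 \<le> 2 a^2 + 2 b^2 twice gives weights 2, 4, 4; the prefactor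
      \<open>L / 2\<close> turns them into the constants L, 2 L, 2 L of the theorem.\<close>
    have sq: "(n 0 \<omega> + (S + \<alpha> * V k \<omega>))\<^sup>2
        \<le> 2 * (n 0 \<omega>)\<^sup>2 + 4 * S\<^sup>2 + 4 * \<alpha>\<^sup>2 * (V k \<omega>)\<^sup>2"
      using sum_squares_bound[of "n 0 \<omega>" "S + \<alpha> * V k \<omega>"] sum_squares_bound[of S "\<alpha> * V k \<omega>"]
      by (simp add: power2_sum power_mult_distrib)
    have "(\<Sum>t\<le>k. ?gap t \<omega>) \<le> (\<Sum>t\<le>k. L / 2 * (n t \<omega>)\<^sup>2)"
      by (intro sum_mono gap_le)
    also have "\<dots> \<le> L / 2 * (\<Sum>t\<le>k. n t \<omega>)\<^sup>2"
      using \<open>L > 0\<close> unfolding sum_distrib_left[symmetric]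
      by (intro mult_left_mono sum_squares_le_square_sum) (auto simp: n_def)
    also have "\<dots> \<le> L / 2 * ((n 0 \<omega> + (S + \<alpha> * V k \<omega>)) / (1 - \<mu>))\<^sup>2"
      using \<open>L > 0\<close> sum_n by (intro mult_left_mono power_mono sum_nonneg) (auto simp: n_def)
    also have "\<dots> \<le> L / 2 * ((2 * (n 0 \<omega>)\<^sup>2 + 4 * S\<^sup>2 + 4 * \<alpha>\<^sup>2 * (V k \<omega>)\<^sup>2) / (1 - \<mu>)\<^sup>2)"
      using \<open>L > 0\<close> sq unfolding power_divide by (intro mult_left_mono divide_right_mono) auto
    also have "\<dots> = bd k \<omega>"
      using \<open>\<mu> < 1\<close> assms(12)[OF \<omega>] by (simp add: bd_def n_def S_def field_simps)
    finally show ?thesis .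
  qed
  have V_int: "integrable M (\<lambda>\<omega>. (V k \<omega>)\<^sup>2)" for k
    unfolding V_def by (intro integrable_square_sum assms(19)) simp
  then have bd_int: "integrable M (bd k)" for k
    by (simp add: bd_def[abs_def])
  have gap_int: "integrable M (?gap t)" for t
  proof (rule Bochner_Integration.integrable_bound[OF bd_int[of t]])
    show "AE \<omega> in M. norm (?gap t \<omega>) \<le> norm (bd t \<omega>)"
    proof (rule AE_I2)
      fix \<omega> assume "\<omega> \<in> space M"
      \<comment> \<open>All gaps are nonnegative, so the cumulative bound \<open>bd t\<close> also
        dominates the single gap at time \<open>t\<close>.\<close>
      have "?gap t \<omega> \<le> (\<Sum>s\<le>t. ?gap s \<omega>)"
        using gap_nonneg by (intro member_le_sum) auto
      also have "\<dots> \<le> bd t \<omega>"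
        using \<open>\<omega> \<in> space M\<close> by (rule gaps_le)
      finally show "norm (?gap t \<omega>) \<le> norm (bd t \<omega>)"
        using gap_nonneg[of t \<omega>] by simp
    qed
  qed simp
  have "(\<Sum>t\<le>T. LINT \<omega>|M. ?gap t \<omega>) = (LINT \<omega>|M. (\<Sum>t\<le>T. ?gap t \<omega>))"
    using gap_int by (simp only: Bochner_Integration.integral_sum)
  also have "\<dots> \<le> (LINT \<omega>|M. bd T \<omega>)"
    using gap_int bd_int gaps_le
    by (intro integral_mono Bochner_Integration.integrable_sum) auto
  also have "\<dots> = L / (1 - \<mu>)\<^sup>2 * (norm (x0 - xs 0))\<^sup>2 + 2 * L / (1 - \<mu>)\<^sup>2 * (\<Sum>t<T. \<sigma> t)\<^sup>2
      + 2 * L * \<alpha>\<^sup>2 / (1 - \<mu>)\<^sup>2 * (LINT \<omega>|M. (V T \<omega>)\<^sup>2)"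
    using V_int by (simp add: bd_def prob_space)
  also have "(LINT \<omega>|M. (V T \<omega>)\<^sup>2) \<le> (\<Sum>t<T. c t)\<^sup>2"
    unfolding V_def by (intro integral_square_sum_le assms(7,19,20)) simp
  finally show ?thesis
    using gap_int \<open>L > 0\<close> by (simp add: mult_left_mono divide_right_mono)
qed

end
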